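(* Let $\lambda\ge 0$ and let $w$ satisfy $$D_t^{\bar\alpha} w(t)+\lambda w(t)=v(t)\quad\text{for }0<t\le T,\qquad w(0)=w_0,$$ where $v\ge 0$ may have a finite number of jump discontinuities in $(0,T)$ (and is continuous otherwise) and is left-continuous on $(0,T]$. Suppose that $w\in C[0,T]\cap W^{1,\infty}(\epsilon,t)$ for all $\epsilon,t$ with $0<\epsilon<t\le T$. If $\alpha_1=1$, suppose also that $w'$ may have jump discontinuities but is a left-continuous function on $(0,T]$. Assume that $w_0\ge 0$. Then $w(t)\ge 0$ for all $t\in[0,T]$.
   Context: $T>0$; $\ell$ is a positive integer; $0<\alpha_\ell<\dots<\alpha_2<\alpha_1\le 1$ are constants; $q_1,\dots,q_\ell\in C[0,T]$ satisfy $q_i(t)\ge 0$ for each $i$ and $\sum_{i=1}^\ell q_i(t)>0$ for all $t\in[0,T]$. The multiterm operator is $D_t^{\bar\alpha}:=\sum_{i=1}^\ell q_i(t)D_t^{\alpha_i}$. For $\alpha_i<1$ the (reformulated Caputo) derivative is defined for $0<t\le T$ by $$\Gamma(1-\alpha_i)\,D_t^{\alpha_i}y(t)=t^{-\alpha_i}[y(t)-y(0)]+\int_0^t\alpha_i(t-s)^{-\alpha_i-1}[y(t)-y(s)]\,ds,$$ while $D_t^{1}y:=y'$. Convention: functions $g$ with finitely many jump discontinuities in $(0,T)$ (including $y'$ when $\alpha_1=1$) are regarded as left-continuous on $(0,T]$, i.e. at a discontinuity point $\tau$ one sets $g(\tau)=\lim_{t\to\tau^-}g(t)$. *)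

theory Defs
  imports "HOL-Analysis.Analysis"
begin

definition smooth_fun :: "(real \<Rightarrow> real) \<Rightarrow> bool" where
  "smooth_fun \<phi> \<longleftrightarrow> (\<forall>n x. (deriv ^^ n) \<phi> differentiable (at x))"

definition test_fun :: "real \<Rightarrow> real \<Rightarrow> (real \<Rightarrow> real) \<Rightarrow> bool" where
  "test_fun a b \<phi> \<longleftrightarrow> smooth_fun \<phi>
     \<and> compact (closure {x. \<phi> x \<noteq> 0}) \<and> closure {x. \<phi> x \<noteq> 0} \<subseteq> {a<..<b}"

definition Linfty :: "real \<Rightarrow> real \<Rightarrow> (real \<Rightarrow> real) set" where
  "Linfty a b = {g. g \<in> borel_measurable (lebesgue_on {a<..<b})
     \<and> (\<exists>C. AE x in lebesgue_on {a<..<b}. \<bar>g x\<bar> \<le> C)}"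

definition weak_deriv :: "real \<Rightarrow> real \<Rightarrow> (real \<Rightarrow> real) \<Rightarrow> (real \<Rightarrow> real) \<Rightarrow> bool" where
  "weak_deriv a b u g \<longleftrightarrow> (\<forall>\<phi>. test_fun a b \<phi> \<longrightarrow>
     (LINT x|lebesgue_on {a<..<b}. u x * deriv \<phi> x)
       = - (LINT x|lebesgue_on {a<..<b}. g x * \<phi> x))"

text \<open>The Sobolev space \<open>W\<^sup>1\<^sup>,\<^sup>\<infinity>(a,b)\<close>, with functions instead of almost-everywhere classes.\<close>

definition Sobolev_1_infty :: "real \<Rightarrow> real \<Rightarrow> (real \<Rightarrow> real) set" where
  "Sobolev_1_infty a b = {u \<in> Linfty a b. \<exists>g \<in> Linfty a b. weak_deriv a b u g}"

text \<open>
  \<open>g\<close> is a left-continuous function on \<open>(0,T]\<close>, continuous except for jump discontinuities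
  at (some of) the points of the finite set \<open>J\<close>. Nothing is required of \<open>g\<close> at \<open>0\<close>.
\<close>

definition left_cont_with_jumps :: "real \<Rightarrow> real set \<Rightarrow> (real \<Rightarrow> real) \<Rightarrow> bool" where
  "left_cont_with_jumps T J g \<longleftrightarrow>
     finite J \<and> J \<subseteq> {0<..<T}
     \<and> continuous_on ({0<..T} - J) g
     \<and> (\<forall>\<tau>\<in>{0<..T}. (g \<longlongrightarrow> g \<tau>) (at_left \<tau>))
     \<and> (\<forall>\<tau>\<in>J. \<exists>L. (g \<longlongrightarrow> L) (at_right \<tau>))"

text \<open>
  The derivative of \<open>y\<close> as a function on \<open>[0,T]\<close> (one-sided at the end points). Where it does
  not exist, that is at a jump of \<open>y'\<close>, the value is the limit of \<open>y'\<close> from the left.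
\<close>

definition first_deriv :: "real \<Rightarrow> (real \<Rightarrow> real) \<Rightarrow> real \<Rightarrow> real" where
  "first_deriv T y t =
     (if y differentiable (at t within {0..T}) then vector_derivative y (at t within {0..T})
      else Lim (at_left t) (\<lambda>s. vector_derivative y (at s within {0..T})))"

definition derivative_with_jumps :: "real \<Rightarrow> (real \<Rightarrow> real) \<Rightarrow> bool" where
  "derivative_with_jumps T y \<longleftrightarrow>
     (\<exists>J. (\<forall>t\<in>{0<..T} - J. y differentiable (at t within {0..T}))
        \<and> left_cont_with_jumps T J (first_deriv T y))"

text \<open>The reformulated Caputo derivative, for \<open>0 < \<alpha> < 1\<close> and \<open>t > 0\<close>.\<close>

definition caputo :: "real \<Rightarrow> (real \<Rightarrow> real) \<Rightarrow> real \<Rightarrow> real" where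
  "caputo \<alpha> y t =
     (t powr (-\<alpha>) * (y t - y 0)
       + (LBINT s:{0<..<t}. \<alpha> * (t - s) powr (-\<alpha> - 1) * (y t - y s))) / Gamma (1 - \<alpha>)"

definition time_deriv :: "real \<Rightarrow> real \<Rightarrow> (real \<Rightarrow> real) \<Rightarrow> real \<Rightarrow> real" where
  "time_deriv T \<alpha> y t = (if \<alpha> = 1 then first_deriv T y t else caputo \<alpha> y t)"

definition multiterm_deriv ::
  "real \<Rightarrow> nat \<Rightarrow> (nat \<Rightarrow> real) \<Rightarrow> (nat \<Rightarrow> real \<Rightarrow> real) \<Rightarrow> (real \<Rightarrow> real) \<Rightarrow> real \<Rightarrow> real" where
  "multiterm_deriv T l \<alpha> q y t = (\<Sum>i=1..l. q i t * time_deriv T (\<alpha> i) y t)"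

end

theory Submission
  imports Defs
begin

text \<open>
  The proof is a minimum principle. If \<open>w\<close> were negative somewhere, then for a small \<open>\<epsilon> > 0\<close> the
  tilted function \<open>s \<mapsto> w s + \<epsilon> * s\<close> would still be negative somewhere, so it has a negative minimum
  over \<open>[0,T]\<close>, at a point \<open>t\<close> that is positive because \<open>w 0 \<ge> 0\<close>. Seen from \<open>t\<close>, every earlier
  value of \<open>w\<close> is larger, by at least \<open>\<epsilon> * (t - s)\<close>. Hence every derivative in the operator is negative
  at \<open>t\<close>: the fractional derivatives because the history of \<open>w\<close> lies above \<open>w t < w 0\<close>
  (\<open>caputo_neg_at_past_minimum\<close>), the first derivative because it is a left limit of slopes and
  cannot exceed \<open>-\<epsilon>\<close> (\<open>first_deriv_le_of_left_slope\<close>). As some \<open>q\<^sub>i t\<close> is positive and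
  \<open>lam * w t \<le> 0\<close>, the left-hand side of the equation is negative at \<open>t\<close>, against \<open>v t \<ge> 0\<close>.

  The tilt serves the case where \<open>lam = 0\<close> and only the first-order term is active at the minimum:
  at a minimum of \<open>w\<close> itself one would merely get \<open>w' \<le> 0\<close>, which contradicts nothing.
\<close>

text \<open>
  The integral is only bounded in sign, which holds whether or not the singular integrand is
  integrable: a Bochner integral that does not converge has the value \<open>0\<close>. The strict sign comes
  from the boundary term \<open>y t - y 0\<close> alone.
\<close>

lemma caputo_neg_at_past_minimum:
  assumes "0 < \<alpha>" and "\<alpha> < 1" and "0 < t" and "y t < y 0"
    and past: "\<And>s. 0 < s \<Longrightarrow> s < t \<Longrightarrow> y t \<le> y s"
  shows "caputo \<alpha> y t < 0"
proof -
  have "0 \<le> (LBINT s:{0<..<t}. - (\<alpha> * (t - s) powr (-\<alpha> - 1) * (y t - y s)))"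
    unfolding set_lebesgue_integral_def
    using assms(1) past
    by (intro Bochner_Integration.integral_nonneg)
      (auto simp: indicator_def intro!: mult_nonneg_nonpos)
  hence "(LBINT s:{0<..<t}. \<alpha> * (t - s) powr (-\<alpha> - 1) * (y t - y s)) \<le> 0"
    by (simp add: set_lebesgue_integral_def)
  moreover have "t powr (-\<alpha>) * (y t - y 0) < 0"
    using assms by (intro mult_pos_neg) auto
  moreover have "Gamma (1 - \<alpha>) > 0"
    using assms by (intro Gamma_real_pos) auto
  ultimately show ?thesis
    unfolding caputo_def by (intro divide_neg_pos) auto
qed

text \<open>
  Left-continuity makes \<open>first_deriv T y t\<close> the left limit of genuine derivatives, also when \<open>t\<close> is
  a jump of \<open>y'\<close>. If this limit exceeded the bound \<open>c\<close>, all derivatives just before \<open>t\<close> would, and by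
  the mean value theorem so would a slope of \<open>y\<close> ending at \<open>t\<close>.
\<close>

lemma first_deriv_le_of_left_slope:
  assumes dj: "derivative_with_jumps T y" and cont: "continuous_on {0..T} y"
    and t: "0 < t" "t \<le> T"
    and slope: "\<And>s. 0 < s \<Longrightarrow> s < t \<Longrightarrow> y t - y s \<le> c * (t - s)"
  shows "first_deriv T y t \<le> c"
proof (rule ccontr)
  assume "\<not> first_deriv T y t \<le> c"
  hence gt: "c < first_deriv T y t" by simp
  obtain J where diff: "\<And>s. s \<in> {0<..T} - J \<Longrightarrow> y differentiable (at s within {0..T})"
    and lc: "left_cont_with_jumps T J (first_deriv T y)"
    using dj unfolding derivative_with_jumps_def by blast
  have fin: "finite J" and lim: "(first_deriv T y \<longlongrightarrow> first_deriv T y t) (at_left t)"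
    using lc t unfolding left_cont_with_jumps_def by auto
  have "eventually (\<lambda>s. c < first_deriv T y s) (at_left t)"
    using order_tendstoD(1)[OF lim gt] .
  moreover have "eventually (\<lambda>s. s \<notin> J) (at_left t)"
    using islimpt_finite[OF fin, of t]
    unfolding islimpt_iff_eventually not_not by (simp add: eventually_at_split)
  moreover have "eventually (\<lambda>s. 0 < s) (at_left t)"
    using eventually_at_left_real[OF t(1)] by eventually_elim auto
  ultimately have "eventually (\<lambda>s. c < first_deriv T y s \<and> s \<notin> J \<and> 0 < s) (at_left t)"
    by eventually_elim auto
  then obtain b where b: "b < t"
    and near: "\<And>s. b < s \<Longrightarrow> s < t \<Longrightarrow> c < first_deriv T y s \<and> s \<notin> J \<and> 0 < s"
    unfolding eventually_at_left_field by blast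
  define a where "a = (b + t) / 2"
  have a: "b < a" "a < t" "0 < a" using b near[of a] by (auto simp: a_def)
  have D: "(y has_derivative (\<lambda>h. h * first_deriv T y s)) (at s)" if "a < s" "s < t" for s
  proof -
    have s: "b < s" "0 < s" "s < T" "s \<notin> J"
      using that a t near[of s] by auto
    have "y differentiable (at s within {0..T})" using diff s by auto
    hence "(y has_vector_derivative first_deriv T y s) (at s within {0..T})"
      by (simp add: first_deriv_def vector_derivative_works)
    thus ?thesis
      using s by (simp add: has_vector_derivative_def at_within_Icc_at)
  qed
  obtain \<xi> where \<xi>: "a < \<xi>" "\<xi> < t" "y t - y a = (t - a) * first_deriv T y \<xi>"
  proof (rule mvt[OF a(2) _ D])
    show "continuous_on {a..t} y"
      using a t by (intro continuous_on_subset[OF cont]) auto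
  qed auto
  have "(t - a) * c < (t - a) * first_deriv T y \<xi>"
    using near[of \<xi>] \<xi> a by (intro mult_strict_left_mono) auto
  with \<xi>(3) slope[OF a(3) a(2)] show False by (simp add: mult.commute)
qed

theorem lemma2p3:
  fixes T lam w0 :: real and l :: nat
    and \<alpha> :: "nat \<Rightarrow> real" and q :: "nat \<Rightarrow> real \<Rightarrow> real"
    and v w :: "real \<Rightarrow> real"
  assumes "T > 0" and "l \<ge> 1"
    and "\<forall>i\<in>{1..l}. 0 < \<alpha> i"
    and "\<forall>i\<in>{1..l}. \<forall>j\<in>{1..l}. i < j \<longrightarrow> \<alpha> j < \<alpha> i"
    and "\<alpha> 1 \<le> 1"
    and "\<forall>i\<in>{1..l}. continuous_on {0..T} (q i)"
    and "\<forall>i\<in>{1..l}. \<forall>t\<in>{0..T}. q i t \<ge> 0"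
    and "\<forall>t\<in>{0..T}. (\<Sum>i=1..l. q i t) > 0"
    and "lam \<ge> 0"
    and "\<forall>t\<in>{0<..T}. multiterm_deriv T l \<alpha> q w t + lam * w t = v t"
    and "w 0 = w0"
    and "\<forall>t\<in>{0<..T}. v t \<ge> 0"
    and "\<exists>J. left_cont_with_jumps T J v"
    and "continuous_on {0..T} w"
    and "\<forall>\<epsilon> t. 0 < \<epsilon> \<and> \<epsilon> < t \<and> t \<le> T \<longrightarrow> w \<in> Sobolev_1_infty \<epsilon> t"
    and "\<alpha> 1 = 1 \<longrightarrow> derivative_with_jumps T w"
    and "w0 \<ge> 0"
  shows "\<forall>t\<in>{0..T}. w t \<ge> 0"
proof (intro ballI, rule ccontr)
  fix t0 assume t0: "t0 \<in> {0..T}" and "\<not> w t0 \<ge> 0"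
  hence neg: "w t0 < 0" by simp
  \<comment> \<open>The tilt adds at most half of \<open>\<bar>w t0\<bar>\<close> on \<open>[0,T]\<close>, so the tilted function stays negative at \<open>t0\<close>.\<close>
  define \<epsilon> where "\<epsilon> = - w t0 / (2 * T)"
  have \<epsilon>: "\<epsilon> > 0" unfolding \<epsilon>_def using neg assms(1) by (intro divide_pos_pos) auto
  have "\<epsilon> * t0 \<le> \<epsilon> * T" using t0 \<epsilon> by simp
  also have "\<epsilon> * T = - w t0 / 2" using assms(1) by (simp add: \<epsilon>_def)
  finally have tilt0: "w t0 + \<epsilon> * t0 < 0" using neg by simp
  have "continuous_on {0..T} (\<lambda>s. w s + \<epsilon> * s)"
    by (intro continuous_intros assms(14))
  then obtain t where tT: "t \<in> {0..T}"
    and min: "\<And>s. s \<in> {0..T} \<Longrightarrow> w t + \<epsilon> * t \<le> w s + \<epsilon> * s"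
    using continuous_attains_inf[of "{0..T}" "\<lambda>s. w s + \<epsilon> * s"] assms(1) by auto
  have tilt: "w t + \<epsilon> * t < 0" using min[OF t0] tilt0 by simp
  have "t \<noteq> 0" using tilt assms(11,17) by auto
  hence t: "0 < t" "t \<le> T" using tT by auto
  have "0 < \<epsilon> * t" using t \<epsilon> by simp
  hence wt: "w t < 0" using tilt by simp
  have slope: "w t - w s \<le> - \<epsilon> * (t - s)" if "0 < s" "s < t" for s
    using min[of s] that t by (simp add: algebra_simps)
  have term_neg: "time_deriv T (\<alpha> i) w t < 0" if i: "i \<in> {1..l}" for i
  proof (cases "\<alpha> i = 1")
    case True
    have "i = 1"
    proof (rule ccontr)
      assume "i \<noteq> 1"
      hence "\<alpha> i < \<alpha> 1" using assms(4)[rule_format, of 1 i] assms(2) i by simp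
      thus False using True assms(5) by simp
    qed
    hence "derivative_with_jumps T w" using True assms(16) by simp
    hence "first_deriv T w t \<le> - \<epsilon>"
      using assms(14) t slope by (rule first_deriv_le_of_left_slope)
    thus ?thesis using True \<epsilon> by (simp add: time_deriv_def)
  next
    case False
    have "\<alpha> i \<le> \<alpha> 1" using assms(4)[rule_format, of 1 i] assms(2) i by (cases "i = 1") auto
    hence "\<alpha> i < 1" using False assms(5) by simp
    moreover have "w t \<le> w s" if "0 < s" "s < t" for s
    proof -
      have "0 \<le> \<epsilon> * (t - s)" using \<epsilon> that by simp
      thus ?thesis using slope[OF that] by simp
    qed
    ultimately have "caputo (\<alpha> i) w t < 0"
      using assms(3,11,17) i t wt by (intro caputo_neg_at_past_minimum) auto
    thus ?thesis using False by (simp add: time_deriv_def)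
  qed
  have q0: "q i t \<ge> 0" if "i \<in> {1..l}" for i using assms(7) tT that by blast
  obtain k where k: "k \<in> {1..l}" "q k t > 0"
  proof (rule ccontr)
    assume "\<not> thesis"
    hence "(\<Sum>i=1..l. q i t) \<le> 0" using that by (intro sum_nonpos) force
    thus False using assms(8) tT by force
  qed
  have "multiterm_deriv T l \<alpha> q w t < (\<Sum>i=1..l. 0)"
    unfolding multiterm_deriv_def
  proof (rule sum_strict_mono_ex1)
    show "\<forall>i\<in>{1..l}. q i t * time_deriv T (\<alpha> i) w t \<le> 0"
      using q0 term_neg by (intro ballI mult_nonneg_nonpos less_imp_le[of _ 0]) blast+
    show "\<exists>i\<in>{1..l}. q i t * time_deriv T (\<alpha> i) w t < 0"
      using k term_neg by (intro bexI[of _ k] mult_pos_neg)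
  qed simp
  moreover have "lam * w t \<le> 0" using assms(9) wt by (simp add: mult_nonneg_nonpos)
  moreover have "multiterm_deriv T l \<alpha> q w t + lam * w t \<ge> 0" using assms(10,12) t by auto
  ultimately show False by simp
qed

end
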